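(* Let $\delta_0\in(0,1/2)$ and consider the segmented linear regression model $X_i=f_\theta(i/n)+\varepsilon_i$, $i=1,\dots,n$, with $\varepsilon_i$ i.i.d. $\mathcal N(0,1)$ and $\theta=(\tau,\alpha_-,\alpha_+,\beta_-,\beta_+)\in\Theta_{\delta_0}$. Let $\mathcal T_n$ be the set of all online detectors. Then there exist positive constants $r_{*J}$ and $r_{*K}$, independent of $n$, such that $$\liminf_{n\to\infty}\ \inf_{\hat\tau_n\in\mathcal T_n}\ \sup_{\theta=(\tau,\alpha_-,\alpha_+,\beta_-,\beta_+)\in\Theta^J_{\delta_0}}\mathbb E_\tau\left[\left(\frac{n}{\log n}(\hat\tau_n-\tau)\right)^2\right]\ge r_{*J}>0$$ and $$\liminf_{n\to\infty}\ \inf_{\hat\tau_n\in\mathcal T_n}\ \sup_{\theta=(\tau,\alpha_-,\alpha_+,\beta_-,\beta_+)\in\Theta^K_{\delta_0}}\mathbb E_\tau\left[\left(\frac{n^{1/3}}{\log^{1/3}n}(\hat\tau_n-\tau)\right)^2\right]\ge r_{*K}>0.$$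
   Context: Signal: for $\theta=(\tau,\alpha_-,\alpha_+,\beta_-,\beta_+)$, $f_\theta(i/n)=\beta_-(i/n-\tau)+\alpha_-$ if $i/n\le\tau$ and $f_\theta(i/n)=\beta_+(i/n-\tau)+\alpha_+$ if $i/n>\tau$. $\mathbb E_\tau$ denotes expectation under the model with parameter $\theta$ (whose change point is $\tau$). Parameter spaces: $\Theta_{\delta_0}=\{\theta:\delta_0\le\tau\le1-\delta_0,\ \max(|\alpha_+-\alpha_-|,|\beta_+-\beta_-|)\ge\delta_0\}$; jump case $\Theta^J_{\delta_0}=\{\theta\in\Theta_{\delta_0}:|\alpha_+-\alpha_-|\ge\delta_0\}$; kink case $\Theta^K_{\delta_0}=\Theta_{\delta_0}\setminus\Theta^J_{\delta_0}$. Online detector: $\hat\tau_n$ is a Markov stopping time with respect to $\{\mathcal F_t,1\le t\le n\}$, where $\mathcal F_t$ is the $\sigma$-algebra generated by $X_1,\dots,X_t$, on the rescaled time grid; that is, $\hat\tau_n$ takes values in $\{1/n,2/n,\dots,1\}$ and $\{\hat\tau_n=t/n\}\in\mathcal F_t$ for every $t\in\{1,\dots,n\}$. *)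

theory Defs
  imports "HOL-Probability.Probability"
begin

text \<open>Parameters are ordered as \<open>(\<tau>, \<alpha>\<^sub>-, \<alpha>\<^sub>+, \<beta>\<^sub>-, \<beta>\<^sub>+)\<close>.\<close>

type_synonym param = "real \<times> real \<times> real \<times> real \<times> real"

fun change_point :: "param \<Rightarrow> real" where
  "change_point (\<tau>, am, ap, bm, bp) = \<tau>"

fun signal :: "param \<Rightarrow> real \<Rightarrow> real" where
  "signal (\<tau>, am, ap, bm, bp) x =
    (if x \<le> \<tau> then bm * (x - \<tau>) + am else bp * (x - \<tau>) + ap)"

definition param_space :: "real \<Rightarrow> param set" where
  "param_space \<delta>0 =
    {(\<tau>, am, ap, bm, bp) | \<tau> am ap bm bp.
      \<delta>0 \<le> \<tau> \<and> \<tau> \<le> 1 - \<delta>0 \<and> max \<bar>ap - am\<bar> \<bar>bp - bm\<bar> \<ge> \<delta>0}"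

definition jump_space :: "real \<Rightarrow> param set" where
  "jump_space \<delta>0 =
    {(\<tau>, am, ap, bm, bp) | \<tau> am ap bm bp.
      (\<tau>, am, ap, bm, bp) \<in> param_space \<delta>0 \<and> \<bar>ap - am\<bar> \<ge> \<delta>0}"

definition kink_space :: "real \<Rightarrow> param set" where
  "kink_space \<delta>0 = param_space \<delta>0 - jump_space \<delta>0"

text \<open>
  The sample space is \<open>\<real>\<^sup>n\<close>, realised as extensional functions on \<open>{1..n}\<close>. The law of the
  observations is the image of the law of \<open>n\<close> independent standard normal errors.
\<close>

definition sample_space :: "nat \<Rightarrow> (nat \<Rightarrow> real) measure" where
  "sample_space n = PiM {1..n} (\<lambda>_. borel)"

definition noise_law :: "nat \<Rightarrow> (nat \<Rightarrow> real) measure" where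
  "noise_law n = PiM {1..n} (\<lambda>_. density lborel (\<lambda>x. ennreal (std_normal_density x)))"

definition observations :: "nat \<Rightarrow> param \<Rightarrow> (nat \<Rightarrow> real) \<Rightarrow> nat \<Rightarrow> real" where
  "observations n \<theta> \<epsilon> = (\<lambda>i\<in>{1..n}. signal \<theta> (real i / real n) + \<epsilon> i)"

definition model_law :: "nat \<Rightarrow> param \<Rightarrow> (nat \<Rightarrow> real) measure" where
  "model_law n \<theta> = distr (noise_law n) (sample_space n) (observations n \<theta>)"

definition observation_filtration :: "nat \<Rightarrow> nat \<Rightarrow> (nat \<Rightarrow> real) measure" where
  "observation_filtration n t =
    sigma (space (sample_space n))
      {(\<lambda>X. X i) -` A \<inter> space (sample_space n) | i A. i \<in> {1..t} \<and> A \<in> sets borel}"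

definition online_detectors :: "nat \<Rightarrow> ((nat \<Rightarrow> real) \<Rightarrow> real) set" where
  "online_detectors n =
    {T. (\<forall>X\<in>space (sample_space n). T X \<in> {real t / real n | t. t \<in> {1..n}}) \<and>
        (\<forall>t\<in>{1..n}. {X \<in> space (sample_space n). T X = real t / real n}
                      \<in> sets (observation_filtration n t))}"

text \<open>
  The mean squared error \<open>E\<^sub>\<tau> [(c (T - \<tau>))\<^sup>2]\<close> for a normalising factor \<open>c\<close>, as a nonnegative
  extended real.
\<close>

definition scaled_risk :: "nat \<Rightarrow> real \<Rightarrow> ((nat \<Rightarrow> real) \<Rightarrow> real) \<Rightarrow> param \<Rightarrow> ennreal" where
  "scaled_risk n c T \<theta> =
    (\<integral>\<^sup>+ X. ennreal ((c * (T X - change_point \<theta>))\<^sup>2) \<partial>model_law n \<theta>)"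

end

(* Change of measure against pure noise. Take M candidate change points at mutual distance 2w, each
   with zero signal before the change. The events that the detector stops within w of a given
   candidate are disjoint, so one of them has probability at most 1/M under pure noise. This event
   is decided by the observations before tau + w, so for it the alternative may be replaced by a
   Gaussian shift of energy E, the squared signal in the window. The likelihood ratio has second
   moment exp E, whence the event has probability at most 1/4 + exp E / M under the alternative.
   If exp E <= M/4, the detector misses the window with probability at least 1/2 and the
   scaled risk is at least (c w)^2 / 2. A jump admits w of order log n / n, a kink w of order
   (log n / n)^(1/3), with E a small multiple of log n. *)

theory Submission
  imports Defs "HOL-Real_Asymp.Real_Asymp"
begin

section \<open>Gaussian likelihood ratios in one dimension\<close>

abbreviation std_gaussian :: "real measure" where
  "std_gaussian \<equiv> density lborel (\<lambda>x. ennreal (std_normal_density x))"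

text \<open>The Radon-Nikodym derivative of the normal law with mean \<open>m\<close> and unit
  variance with respect to the standard normal law.\<close>

definition gaussian_lr :: "real \<Rightarrow> real \<Rightarrow> real" where
  "gaussian_lr m x = exp (m * x - m\<^sup>2 / 2)"

lemma gaussian_lr_measurable [measurable]: "gaussian_lr m \<in> borel_measurable borel"
  unfolding gaussian_lr_def by measurable

lemma prob_space_std_gaussian: "prob_space std_gaussian"
  by (rule prob_space_normal_density) simp

text \<open>Translation invariance of Lebesgue measure moves the shift into the density; expanding
  the square in its exponent then splits off the likelihood ratio.\<close>

lemma distr_std_gaussian_shift:
  "distr std_gaussian borel ((+) m) = density std_gaussian (\<lambda>x. ennreal (gaussian_lr m x))"
proof -
  \<comment> \<open>Writing \<open>x\<close> as \<open>(m + x) - m\<close> makes the density a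
    function of the shifted point, the form that \<open>density_distr\<close> asks for.\<close>
  have "distr std_gaussian borel ((+) m)
      = distr (density lborel (\<lambda>x. ennreal (std_normal_density ((m + x) - m)))) borel ((+) m)"
    by simp
  also have "\<dots> = density (distr lborel borel ((+) m)) (\<lambda>y. ennreal (std_normal_density (y - m)))"
    by (subst density_distr) auto
  also have "\<dots> = density lborel (\<lambda>y. ennreal (std_normal_density (y - m)))"
    by (simp add: lborel_distr_plus)
  also have "\<dots> = density lborel (\<lambda>y. ennreal (std_normal_density y) * ennreal (gaussian_lr m y))"
  proof (rule density_cong)
    have "std_normal_density (y - m) = std_normal_density y * gaussian_lr m y" for y
    proof -
      have "- (y - m)\<^sup>2 / 2 = - y\<^sup>2 / 2 + (m * y - m\<^sup>2 / 2)"
        by (simp add: power2_eq_square field_simps)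
      then have "exp (- (y - m)\<^sup>2 / 2) = exp (- y\<^sup>2 / 2) * exp (m * y - m\<^sup>2 / 2)"
        by (metis exp_add)
      then show ?thesis
        by (simp add: std_normal_density_def gaussian_lr_def)
    qed
    then show "AE y in lborel. ennreal (std_normal_density (y - m))
        = ennreal (std_normal_density y) * ennreal (gaussian_lr m y)"
      by (simp add: ennreal_mult gaussian_lr_def)
  qed auto
  also have "\<dots> = density std_gaussian (\<lambda>x. ennreal (gaussian_lr m x))"
    by (subst density_density_eq) auto
  finally show ?thesis .
qed

text \<open>Squaring the ratio for mean \<open>m\<close> gives \<open>exp (m\<^sup>2)\<close> times
  the ratio for mean \<open>2 * m\<close>, and the latter integrates to one, being a probability
  density.\<close>

lemma nn_integral_gaussian_lr_square:
  "(\<integral>\<^sup>+x. ennreal ((gaussian_lr m x)\<^sup>2) \<partial>std_gaussian) = ennreal (exp (m\<^sup>2))"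
proof -
  have sq: "(gaussian_lr m x)\<^sup>2 = exp (m\<^sup>2) * gaussian_lr (2 * m) x" for x
    unfolding gaussian_lr_def power2_eq_square mult_exp_exp by (simp add: field_simps)
  interpret S: prob_space "distr std_gaussian borel ((+) (2 * m))"
    by (rule prob_space.prob_space_distr[OF prob_space_std_gaussian]) simp
  have "1 = emeasure (density std_gaussian (\<lambda>x. ennreal (gaussian_lr (2 * m) x))) UNIV"
    using S.emeasure_space_1 by (simp add: distr_std_gaussian_shift)
  also have "\<dots> = (\<integral>\<^sup>+x. ennreal (gaussian_lr (2 * m) x) \<partial>std_gaussian)"
    by (subst emeasure_density) auto
  finally have one: "(\<integral>\<^sup>+x. ennreal (gaussian_lr (2 * m) x) \<partial>std_gaussian) = 1" by simp
  have "(\<integral>\<^sup>+x. ennreal ((gaussian_lr m x)\<^sup>2) \<partial>std_gaussian)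
      = (\<integral>\<^sup>+x. ennreal (exp (m\<^sup>2)) * ennreal (gaussian_lr (2 * m) x) \<partial>std_gaussian)"
    by (simp add: sq ennreal_mult')
  also have "\<dots> = ennreal (exp (m\<^sup>2)) * (\<integral>\<^sup>+x. ennreal (gaussian_lr (2 * m) x) \<partial>std_gaussian)"
    by (rule nn_integral_cmult) auto
  finally show ?thesis by (simp add: one)
qed

section \<open>Change of measure for the whole sample\<close>

lemma product_sigma_finite_std_gaussian: "product_sigma_finite (\<lambda>_::nat. std_gaussian)"
  by (simp add: product_sigma_finite_def prob_space_imp_sigma_finite prob_space_std_gaussian)

lemma prob_space_noise_law: "prob_space (noise_law n)"
  unfolding noise_law_def by (intro prob_space_PiM prob_space_std_gaussian)

lemma sets_noise_law [measurable_cong]: "sets (noise_law n) = sets (sample_space n)"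
  unfolding noise_law_def sample_space_def by (intro sets_PiM_cong) auto

lemma space_noise_law: "space (noise_law n) = space (sample_space n)"
  by (rule sets_eq_imp_space_eq[OF sets_noise_law])

definition mean_shift :: "nat \<Rightarrow> (nat \<Rightarrow> real) \<Rightarrow> (nat \<Rightarrow> real) \<Rightarrow> nat \<Rightarrow> real" where
  "mean_shift n m \<epsilon> = (\<lambda>i\<in>{1..n}. m i + \<epsilon> i)"

lemma coordinate_measurable [measurable]:
  "i \<in> {1..n} \<Longrightarrow> (\<lambda>x. x i) \<in> borel_measurable (sample_space n)"
  unfolding sample_space_def by measurable

lemma mean_shift_measurable [measurable]:
  "mean_shift n m \<in> measurable (sample_space n) (sample_space n)"
  unfolding mean_shift_def sample_space_def by measurable

definition sample_lr :: "nat \<Rightarrow> (nat \<Rightarrow> real) \<Rightarrow> (nat \<Rightarrow> real) \<Rightarrow> real" where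
  "sample_lr n m x = (\<Prod>i\<in>{1..n}. gaussian_lr (m i) (x i))"

lemma sample_lr_measurable [measurable]: "sample_lr n m \<in> borel_measurable (sample_space n)"
  unfolding sample_lr_def sample_space_def by measurable

text \<open>By independence the second moments multiply, so the squared means add up in the exponent
  to the energy of the shift.\<close>

lemma nn_integral_sample_lr_square:
  "(\<integral>\<^sup>+x. ennreal ((sample_lr n m x)\<^sup>2) \<partial>noise_law n) = ennreal (exp (\<Sum>i\<in>{1..n}. (m i)\<^sup>2))"
proof -
  interpret product_sigma_finite "\<lambda>_::nat. std_gaussian"
    by (rule product_sigma_finite_std_gaussian)
  have "(\<integral>\<^sup>+x. ennreal ((sample_lr n m x)\<^sup>2) \<partial>noise_law n)
      = (\<integral>\<^sup>+x. (\<Prod>i\<in>{1..n}. ennreal ((gaussian_lr (m i) (x i))\<^sup>2)) \<partial>noise_law n)"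
    by (simp add: sample_lr_def prod_power_distrib prod_ennreal)
  also have "\<dots> = (\<Prod>i\<in>{1..n}. \<integral>\<^sup>+x. ennreal ((gaussian_lr (m i) x)\<^sup>2) \<partial>std_gaussian)"
    unfolding noise_law_def by (intro product_nn_integral_prod) auto
  also have "\<dots> = ennreal (exp (\<Sum>i\<in>{1..n}. (m i)\<^sup>2))"
    by (simp add: nn_integral_gaussian_lr_square prod_ennreal exp_sum)
  finally show ?thesis .
qed

text \<open>Both sides are identified with the product of the shifted normal laws; a product measure
  is determined by its values on boxes.\<close>

lemma distr_noise_law_mean_shift:
  "distr (noise_law n) (sample_space n) (mean_shift n m)
    = density (noise_law n) (\<lambda>x. ennreal (sample_lr n m x))"
proof -
  interpret G: product_sigma_finite "\<lambda>_::nat. std_gaussian"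
    by (rule product_sigma_finite_std_gaussian)
  define N where "N i = distr std_gaussian borel ((+) (m i))" for i
  have N_prob: "prob_space (N i)" for i
    unfolding N_def by (rule prob_space.prob_space_distr[OF prob_space_std_gaussian]) simp
  interpret N: product_sigma_finite N
    by (simp add: product_sigma_finite_def prob_space_imp_sigma_finite N_prob)
  have sets_N: "sets (PiM {1..n} N) = sets (sample_space n)"
    unfolding sample_space_def by (intro sets_PiM_cong) (auto simp: N_def)
  have "distr (noise_law n) (sample_space n) (mean_shift n m) = PiM {1..n} N"
  proof (rule N.PiM_eqI)
    fix A assume A: "\<And>i. i \<in> {1..n} \<Longrightarrow> A i \<in> sets (N i)"
    have box: "Pi\<^sub>E {1..n} A \<in> sets (sample_space n)"
      unfolding sample_space_def using A by (intro sets_PiM_I_finite) (auto simp: N_def)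
    have "emeasure (distr (noise_law n) (sample_space n) (mean_shift n m)) (Pi\<^sub>E {1..n} A)
        = emeasure (noise_law n) (mean_shift n m -` Pi\<^sub>E {1..n} A \<inter> space (noise_law n))"
      using box by (subst emeasure_distr) auto
    \<comment> \<open>A coordinatewise shift pulls a box back to a box.\<close>
    also have "mean_shift n m -` Pi\<^sub>E {1..n} A \<inter> space (noise_law n)
        = Pi\<^sub>E {1..n} (\<lambda>i. (+) (m i) -` A i)"
      by (auto simp: noise_law_def space_PiM mean_shift_def PiE_iff extensional_def)
    also have "emeasure (noise_law n) \<dots> = (\<Prod>i\<in>{1..n}. emeasure std_gaussian ((+) (m i) -` A i))"
    proof -
      have "(+) (m i) -` A i \<in> sets borel" if "i \<in> {1..n}" for i
        using measurable_sets[of "(+) (m i)" borel borel "A i"] A[OF that] by (simp add: N_def)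
      then show ?thesis
        unfolding noise_law_def by (intro G.emeasure_PiM) auto
    qed
    also have "\<dots> = (\<Prod>i\<in>{1..n}. emeasure (N i) (A i))"
      unfolding N_def using A by (intro prod.cong refl, subst emeasure_distr) (auto simp: N_def)
    finally show "emeasure (distr (noise_law n) (sample_space n) (mean_shift n m)) (Pi\<^sub>E {1..n} A)
        = (\<Prod>i\<in>{1..n}. emeasure (N i) (A i))" .
  qed (simp_all only: sets_distr sets_N finite_atLeastAtMost)
  also have "\<dots> = density (noise_law n) (\<lambda>x. ennreal (sample_lr n m x))"
  proof (rule N.PiM_eqI[symmetric])
    fix A assume A: "\<And>i. i \<in> {1..n} \<Longrightarrow> A i \<in> sets (N i)"
    have box: "Pi\<^sub>E {1..n} A \<in> sets (sample_space n)"
      unfolding sample_space_def using A by (intro sets_PiM_I_finite) (auto simp: N_def)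
    \<comment> \<open>With the indicator factored like the likelihood ratio, the integral over a box
      splits into one-dimensional integrals.\<close>
    have ind: "indicator (Pi\<^sub>E {1..n} A) x = (\<Prod>i\<in>{1..n}. indicator (A i) (x i) :: ennreal)"
      if "x \<in> space (noise_law n)" for x
      using that by (auto simp: noise_law_def space_PiM PiE_iff indicator_def)
    have "emeasure (density (noise_law n) (\<lambda>x. ennreal (sample_lr n m x))) (Pi\<^sub>E {1..n} A)
        = (\<integral>\<^sup>+x. ennreal (sample_lr n m x) * indicator (Pi\<^sub>E {1..n} A) x \<partial>noise_law n)"
      using box by (subst emeasure_density) (auto simp: sets_noise_law)
    also have "\<dots> = (\<integral>\<^sup>+x. (\<Prod>i\<in>{1..n}. ennreal (gaussian_lr (m i) (x i)) * indicator (A i) (x i)) \<partial>noise_law n)"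
      by (intro nn_integral_cong)
        (simp add: ind sample_lr_def prod.distrib prod_ennreal gaussian_lr_def del: One_nat_def)
    also have "\<dots> = (\<Prod>i\<in>{1..n}. \<integral>\<^sup>+x. ennreal (gaussian_lr (m i) x) * indicator (A i) x \<partial>std_gaussian)"
      unfolding noise_law_def using A by (intro G.product_nn_integral_prod) (auto simp: N_def)
    also have "\<dots> = (\<Prod>i\<in>{1..n}. emeasure (N i) (A i))"
    proof (rule prod.cong[OF refl])
      fix i assume "i \<in> {1..n}"
      then have "A i \<in> sets borel" using A[of i] by (simp add: N_def)
      then show "(\<integral>\<^sup>+x. ennreal (gaussian_lr (m i) x) * indicator (A i) x \<partial>std_gaussian) = emeasure (N i) (A i)"
        unfolding N_def distr_std_gaussian_shift by (intro emeasure_density[symmetric]) auto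
    qed
    finally show "emeasure (density (noise_law n) (\<lambda>x. ennreal (sample_lr n m x))) (Pi\<^sub>E {1..n} A)
        = (\<Prod>i\<in>{1..n}. emeasure (N i) (A i))" .
  qed (simp_all only: sets_density sets_N sets_noise_law finite_atLeastAtMost)
  finally show ?thesis .
qed

text \<open>
  Cauchy--Schwarz, linearised: for the likelihood ratio \<open>l\<close>, integrate
  \<open>l \<le> l\<^sup>2 / (4 exp E) + exp E\<close> over the event.
\<close>

lemma mean_shift_emeasure_le:
  assumes A: "A \<in> sets (sample_space n)" and E: "(\<Sum>i\<in>{1..n}. (m i)\<^sup>2) \<le> E"
  shows "emeasure (distr (noise_law n) (sample_space n) (mean_shift n m)) A
    \<le> ennreal (1 / 4) + ennreal (exp E) * emeasure (noise_law n) A"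
proof -
  have pw: "l \<le> l\<^sup>2 * (1 / (4 * exp E)) + exp E" for l :: real
  proof -
    have "0 \<le> (l - 2 * exp E)\<^sup>2 / (4 * exp E)" by simp
    also have "\<dots> = l\<^sup>2 * (1 / (4 * exp E)) + exp E - l"
      by (simp add: power2_eq_square field_simps)
    finally show ?thesis by simp
  qed
  have pw': "ennreal (sample_lr n m x) * indicator A x
      \<le> ennreal (1 / (4 * exp E)) * ennreal ((sample_lr n m x)\<^sup>2) + ennreal (exp E) * indicator A x" for x
    using pw[of "sample_lr n m x"]
    by (auto simp: indicator_def ennreal_mult[symmetric] ennreal_plus[symmetric] ac_simps
        simp del: ennreal_plus intro!: ennreal_leI)
  have "emeasure (distr (noise_law n) (sample_space n) (mean_shift n m)) A
      = (\<integral>\<^sup>+x. ennreal (sample_lr n m x) * indicator A x \<partial>noise_law n)"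
    unfolding distr_noise_law_mean_shift
    using A by (subst emeasure_density) (auto simp: sets_noise_law)
  also have "\<dots> \<le> (\<integral>\<^sup>+x. ennreal (1 / (4 * exp E)) * ennreal ((sample_lr n m x)\<^sup>2)
      + ennreal (exp E) * indicator A x \<partial>noise_law n)"
    by (intro nn_integral_mono pw')
  also have "\<dots> = ennreal (1 / (4 * exp E)) * ennreal (exp (\<Sum>i\<in>{1..n}. (m i)\<^sup>2))
      + ennreal (exp E) * emeasure (noise_law n) A"
    using A by (simp add: nn_integral_add nn_integral_cmult nn_integral_sample_lr_square sets_noise_law)
  \<comment> \<open>The weight \<open>1 / (4 * exp E)\<close> is chosen for this: the second moment
    is at most \<open>exp E\<close>, so its share is at most \<open>1 / 4\<close>.\<close>
  also have "\<dots> \<le> ennreal (1 / 4) + ennreal (exp E) * emeasure (noise_law n) A"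
    using E by (intro add_right_mono) (auto simp: ennreal_mult[symmetric] intro!: ennreal_leI)
  finally show ?thesis .
qed

section \<open>Stopping events, truncated signals and risk\<close>

lemma sets_observation_filtration_subset:
  assumes "t \<le> n"
  shows "sets (observation_filtration n t) \<subseteq> sets (sample_space n)"
proof -
  have "(\<lambda>X. X i) -` A \<inter> space (sample_space n) \<in> sets (sample_space n)"
    if "i \<in> {1..t}" "A \<in> sets borel" for i and A :: "real set"
    using that assms by (intro measurable_sets[OF coordinate_measurable]) auto
  then show ?thesis
    unfolding observation_filtration_def
    by (subst sets_measure_of) (auto intro!: sets.sigma_sets_subset)
qed

text \<open>Dependence on the first \<open>t\<close> coordinates alone is evident for the generators
  and survives complements and countable unions.\<close>

lemma observation_filtration_cong:
  assumes A: "A \<in> sets (observation_filtration n t)"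
    and X: "X \<in> space (sample_space n)" and Y: "Y \<in> space (sample_space n)"
    and eq: "\<And>i. i \<in> {1..t} \<Longrightarrow> X i = Y i"
  shows "X \<in> A \<longleftrightarrow> Y \<in> A"
proof -
  have "A \<in> sigma_sets (space (sample_space n))
      {(\<lambda>X. X i) -` A \<inter> space (sample_space n) | i A. i \<in> {1..t} \<and> A \<in> sets borel}"
    using A unfolding observation_filtration_def by (subst (asm) sets_measure_of) auto
  then show ?thesis
  proof induction
    case (Basic a)
    then show ?case using X Y eq by auto
  qed (use X Y in auto)
qed

lemma model_law_eq_mean_shift:
  "model_law n \<theta> = distr (noise_law n) (sample_space n) (mean_shift n (\<lambda>i. signal \<theta> (real i / real n)))"
proof -
  have "observations n \<theta> = mean_shift n (\<lambda>i. signal \<theta> (real i / real n))"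
    by (rule ext) (simp only: observations_def mean_shift_def)
  then show ?thesis by (simp only: model_law_def)
qed

text \<open>The full and the truncated means, added to the same noise, give samples that agree on
  \<open>S\<close>; hence \<open>A\<close> has the same preimage under both shifts. No comparison of
  the two laws beyond \<open>A\<close> is made.\<close>

lemma emeasure_model_law_truncate:
  assumes A: "A \<in> sets (sample_space n)"
    and cong: "\<And>X Y. X \<in> space (sample_space n) \<Longrightarrow> Y \<in> space (sample_space n)
      \<Longrightarrow> (\<And>i. i \<in> {1..n} \<inter> S \<Longrightarrow> X i = Y i) \<Longrightarrow> X \<in> A \<longleftrightarrow> Y \<in> A"
  shows "emeasure (model_law n \<theta>) A
    = emeasure (distr (noise_law n) (sample_space n)
        (mean_shift n (\<lambda>i. if i \<in> S then signal \<theta> (real i / real n) else 0))) A"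
proof -
  let ?f = "mean_shift n (\<lambda>i. signal \<theta> (real i / real n))"
  let ?g = "mean_shift n (\<lambda>i. if i \<in> S then signal \<theta> (real i / real n) else 0)"
  have "mean_shift n m \<epsilon> \<in> space (sample_space n)" if "\<epsilon> \<in> space (noise_law n)" for m \<epsilon>
    using measurable_space[OF mean_shift_measurable] that by (simp add: space_noise_law)
  then have "?f \<epsilon> \<in> A \<longleftrightarrow> ?g \<epsilon> \<in> A" if "\<epsilon> \<in> space (noise_law n)" for \<epsilon>
    using that by (intro cong) (auto simp: mean_shift_def)
  then have "?f -` A \<inter> space (noise_law n) = ?g -` A \<inter> space (noise_law n)"
    by auto
  then show ?thesis
    using A by (simp add: model_law_eq_mean_shift emeasure_distr)
qed

text \<open>Truncation comes before the change of measure, so only the signal on \<open>S\<close> is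
  charged to the energy.\<close>

lemma emeasure_model_law_le:
  assumes "A \<in> sets (sample_space n)"
    and "\<And>X Y. X \<in> space (sample_space n) \<Longrightarrow> Y \<in> space (sample_space n)
      \<Longrightarrow> (\<And>i. i \<in> {1..n} \<inter> S \<Longrightarrow> X i = Y i) \<Longrightarrow> X \<in> A \<longleftrightarrow> Y \<in> A"
    and E: "(\<Sum>i\<in>{1..n} \<inter> S. (signal \<theta> (real i / real n))\<^sup>2) \<le> E"
  shows "emeasure (model_law n \<theta>) A \<le> ennreal (1 / 4) + ennreal (exp E) * emeasure (noise_law n) A"
proof -
  have "(\<Sum>i\<in>{1..n}. (if i \<in> S then signal \<theta> (real i / real n) else 0)\<^sup>2)
      = (\<Sum>i\<in>{1..n} \<inter> S. (signal \<theta> (real i / real n))\<^sup>2)"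
    by (intro sum.mono_neutral_cong_right) auto
  with E have energy: "(\<Sum>i\<in>{1..n}. (if i \<in> S then signal \<theta> (real i / real n) else 0)\<^sup>2) \<le> E"
    by (simp only:)
  have "emeasure (model_law n \<theta>) A = emeasure (distr (noise_law n) (sample_space n)
      (mean_shift n (\<lambda>i. if i \<in> S then signal \<theta> (real i / real n) else 0))) A"
    using assms(1,2) by (rule emeasure_model_law_truncate)
  also have "\<dots> \<le> ennreal (1 / 4) + ennreal (exp E) * emeasure (noise_law n) A"
    using assms(1) energy by (rule mean_shift_emeasure_le)
  finally show ?thesis .
qed

lemma prob_space_model_law: "prob_space (model_law n \<theta>)"
  unfolding model_law_eq_mean_shift
  by (intro prob_space.prob_space_distr prob_space_noise_law)
    (simp add: measurable_cong_sets[OF sets_noise_law refl])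

text \<open>Markov's inequality: off \<open>A\<close> the error is at least \<open>w\<close>, and
  this complement has probability at least \<open>1 / 2\<close>.\<close>

lemma scaled_risk_ge:
  fixes n :: nat and T :: "(nat \<Rightarrow> real) \<Rightarrow> real" and \<theta> :: param and w c :: real
  defines "A \<equiv> {X \<in> space (sample_space n). \<bar>T X - change_point \<theta>\<bar> < w}"
  assumes meas: "A \<in> sets (sample_space n)"
    and p: "emeasure (model_law n \<theta>) A \<le> ennreal (1 / 2)" and w: "0 \<le> w"
  shows "ennreal ((c * w)\<^sup>2 / 2) \<le> scaled_risk n c T \<theta>"
proof -
  interpret prob_space "model_law n \<theta>" by (rule prob_space_model_law)
  have sets_eq: "sets (model_law n \<theta>) = sets (sample_space n)"
    and space_eq: "space (model_law n \<theta>) = space (sample_space n)"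
    by (simp_all add: model_law_def)
  let ?B = "space (model_law n \<theta>) - A"
  have A: "A \<in> events" using meas by (simp add: sets_eq)
  then have "prob ?B \<ge> 1 / 2"
    using p[unfolded emeasure_eq_measure, THEN ennreal_le_iff[THEN iffD1, rotated]]
    by (simp add: prob_compl)
  then have "ennreal ((c * w)\<^sup>2 / 2) \<le> ennreal ((c * w)\<^sup>2) * emeasure (model_law n \<theta>) ?B"
    using mult_left_mono[of "1 / 2" "prob ?B" "(c * w)\<^sup>2"]
    by (auto simp: emeasure_eq_measure ennreal_mult[symmetric] intro!: ennreal_leI)
  also have "\<dots> = (\<integral>\<^sup>+X. ennreal ((c * w)\<^sup>2) * indicator ?B X \<partial>model_law n \<theta>)"
    using A by (simp add: nn_integral_cmult_indicator)
  also have "\<dots> \<le> scaled_risk n c T \<theta>"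
    unfolding scaled_risk_def
  proof (rule nn_integral_mono)
    fix X
    have "(c * w)\<^sup>2 \<le> (c * (T X - change_point \<theta>))\<^sup>2" if "X \<in> ?B"
    proof -
      have "w \<le> \<bar>T X - change_point \<theta>\<bar>" using that by (auto simp: A_def space_eq)
      then have "w\<^sup>2 \<le> (T X - change_point \<theta>)\<^sup>2"
        using w by (metis abs_le_square_iff abs_of_nonneg)
      then show ?thesis by (simp add: power_mult_distrib mult_left_mono)
    qed
    then show "ennreal ((c * w)\<^sup>2) * indicator ?B X \<le> ennreal ((c * (T X - change_point \<theta>))\<^sup>2)"
      by (auto simp: indicator_def simp del: DiffE intro!: ennreal_leI)
  qed
  finally show ?thesis .
qed

text \<open>This is where the online property enters. The window event is a finite union of events
  \<open>T X = t / n\<close> with \<open>t / n < \<tau> + w\<close>, each decided by the first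
  \<open>t\<close> observations.\<close>

lemma online_detector_window:
  fixes \<tau> w :: real
  assumes T: "T \<in> online_detectors n"
  defines "A \<equiv> {X \<in> space (sample_space n). \<bar>T X - \<tau>\<bar> < w}"
  shows "A \<in> sets (sample_space n)"
    and "\<And>X Y. X \<in> space (sample_space n) \<Longrightarrow> Y \<in> space (sample_space n)
      \<Longrightarrow> (\<And>i. i \<in> {1..n} \<inter> {i. real i / real n < \<tau> + w} \<Longrightarrow> X i = Y i) \<Longrightarrow> X \<in> A \<longleftrightarrow> Y \<in> A"
proof -
  define D where "D t = {X \<in> space (sample_space n). T X = real t / real n}" for t
  define I where "I = {t \<in> {1..n}. \<bar>real t / real n - \<tau>\<bar> < w}"
  have D: "D t \<in> sets (observation_filtration n t)" if "t \<in> {1..n}" for t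
    using T that by (auto simp: online_detectors_def D_def)
  have A_eq: "A = (\<Union>t\<in>I. D t)"
    using T unfolding A_def I_def D_def online_detectors_def by fastforce
  show "A \<in> sets (sample_space n)"
    unfolding A_eq using D sets_observation_filtration_subset
    by (intro sets.finite_UN) (auto simp: I_def subset_iff)
  fix X Y
  assume X: "X \<in> space (sample_space n)" and Y: "Y \<in> space (sample_space n)"
    and eq: "\<And>i. i \<in> {1..n} \<inter> {i. real i / real n < \<tau> + w} \<Longrightarrow> X i = Y i"
  have "X \<in> D t \<longleftrightarrow> Y \<in> D t" if t: "t \<in> I" for t
  proof (rule observation_filtration_cong[OF _ X Y])
    show "D t \<in> sets (observation_filtration n t)" using D t by (auto simp: I_def)
    fix i assume i: "i \<in> {1..t}"
    have "real i / real n \<le> real t / real n" using i by (intro divide_right_mono) auto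
    also have "\<dots> < \<tau> + w" using t by (auto simp: I_def)
    finally show "X i = Y i" using i t by (intro eq) (auto simp: I_def)
  qed
  then show "X \<in> A \<longleftrightarrow> Y \<in> A" by (auto simp: A_eq)
qed

section \<open>Many candidate change points\<close>

lemma (in prob_space) disjoint_family_small_prob:
  assumes "m > 0" and "\<And>j. j < m \<Longrightarrow> A j \<in> events" and "disjoint_family_on A {..<m}"
  obtains j where "j < m" and "prob (A j) \<le> 1 / real m"
proof -
  have "\<exists>j<m. prob (A j) \<le> 1 / real m"
  proof (rule ccontr)
    assume "\<not> ?thesis"
    then have "(\<Sum>j<m. 1 / real m) < (\<Sum>j<m. prob (A j))"
      using assms(1) by (intro sum_strict_mono) (auto simp: not_le)
    also have "\<dots> = prob (\<Union>j<m. A j)"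
      using assms by (intro finite_measure_finite_Union[symmetric]) auto
    also have "\<dots> \<le> 1" by simp
    finally show False using assms(1) by simp
  qed
  then show thesis using that by blast
qed

lemma online_detector_risk_ge:
  assumes T: "T \<in> online_detectors n" and M: "M > 0" and w: "w > 0"
    and \<theta>: "\<And>j. j < M \<Longrightarrow> \<theta> j \<in> \<Theta>"
    and cp: "\<And>j. j < M \<Longrightarrow> change_point (\<theta> j) = a + 2 * real j * w"
    and E: "\<And>j. j < M \<Longrightarrow>
      (\<Sum>i\<in>{1..n} \<inter> {i. real i / real n < change_point (\<theta> j) + w}. (signal (\<theta> j) (real i / real n))\<^sup>2) \<le> E"
    and small: "exp E \<le> real M / 4"
  shows "ennreal ((c * w)\<^sup>2 / 2) \<le> (SUP \<theta>\<in>\<Theta>. scaled_risk n c T \<theta>)"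
proof -
  define A where "A j = {X \<in> space (sample_space n). \<bar>T X - change_point (\<theta> j)\<bar> < w}" for j
  have A: "A j \<in> sets (sample_space n)" for j
    unfolding A_def by (rule online_detector_window(1)[OF T])
  interpret prob_space "noise_law n" by (rule prob_space_noise_law)
  have "disjoint_family_on A {..<M}"
  proof -
    have False if "j < k" "k < M" "X \<in> A j" "X \<in> A k" for j k X
    proof -
      \<comment> \<open>Distinct candidates are at least \<open>2 * w\<close> apart, so open windows
        of radius \<open>w\<close> cannot meet.\<close>
      have "real j + 1 \<le> real k" using that(1) by simp
      then have "(real j + 1) * w \<le> real k * w" using w by (intro mult_right_mono) auto
      then have "2 * real j * w + 2 * w \<le> 2 * real k * w" by (simp add: algebra_simps)
      then show False using that cp[of j] cp[of k] by (auto simp: A_def abs_less_iff)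
    qed
    then show ?thesis
      unfolding disjoint_family_on_def by (metis disjoint_iff lessThan_iff linorder_neqE_nat)
  qed
  \<comment> \<open>The index may depend on \<open>T\<close>: the supremum over parameters is taken
    for a fixed detector.\<close>
  then obtain j where j: "j < M" and pj: "prob (A j) \<le> 1 / real M"
    using disjoint_family_small_prob[OF M] A by (metis sets_noise_law)
  have "emeasure (model_law n (\<theta> j)) (A j)
      \<le> ennreal (1 / 4) + ennreal (exp E) * emeasure (noise_law n) (A j)"
    unfolding A_def
    by (rule emeasure_model_law_le[OF online_detector_window[OF T] E[OF j]])
  also have "\<dots> \<le> ennreal (1 / 4) + ennreal (1 / 4)"
  proof -
    have "exp E * prob (A j) \<le> real M / 4 * (1 / real M)"
      using small pj by (intro mult_mono) auto
    then show ?thesis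
      using M by (intro add_left_mono)
        (auto simp: emeasure_eq_measure ennreal_mult[symmetric] intro!: ennreal_leI)
  qed
  also have "\<dots> = ennreal (1 / 2)" by (simp add: ennreal_plus[symmetric] del: ennreal_plus)
  finally have "ennreal ((c * w)\<^sup>2 / 2) \<le> scaled_risk n c T (\<theta> j)"
    using A[of j] w unfolding A_def by (intro scaled_risk_ge) auto
  then show ?thesis using \<theta>[OF j] by (rule SUP_upper2[rotated])
qed

section \<open>Energy of the signal in a window\<close>

lemma card_nat_open_interval_le:
  fixes a l :: real
  assumes "0 \<le> a" and "0 \<le> l"
  shows "real (card {i::nat. a < real i \<and> real i < a + l}) \<le> l + 1"
proof -
  let ?S = "{i::nat. a < real i \<and> real i < a + l}"
  have "?S \<subseteq> {nat \<lfloor>a\<rfloor> + 1..<nat \<lceil>a + l\<rceil>}"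
  proof
    fix i assume "i \<in> ?S"
    then have "\<lfloor>a\<rfloor> < int i" "int i < \<lceil>a + l\<rceil>" by (auto simp: floor_less_iff less_ceiling_iff)
    moreover have "0 \<le> \<lfloor>a\<rfloor>" using assms by simp
    ultimately have "nat \<lfloor>a\<rfloor> < i" "i < nat \<lceil>a + l\<rceil>" by linarith+
    then show "i \<in> {nat \<lfloor>a\<rfloor> + 1..<nat \<lceil>a + l\<rceil>}" by simp
  qed
  then have "card ?S \<le> nat \<lceil>a + l\<rceil> - (nat \<lfloor>a\<rfloor> + 1)"
    using card_mono[of "{nat \<lfloor>a\<rfloor> + 1..<nat \<lceil>a + l\<rceil>}" ?S] by simp
  moreover have "real (nat \<lceil>a + l\<rceil> - (nat \<lfloor>a\<rfloor> + 1)) \<le> l + 1"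
    using assms by linarith
  ultimately show ?thesis by linarith
qed

text \<open>Grid points up to \<open>\<tau>\<close> contribute nothing, and the window holds at most
  \<open>n * w + 1\<close> grid points beyond \<open>\<tau>\<close>.\<close>

lemma signal_energy_le:
  assumes n: "n > 0" and \<tau>: "0 \<le> \<tau>" and w: "0 \<le> w"
    and before: "\<And>x. x \<le> \<tau> \<Longrightarrow> signal \<theta> x = 0"
    and after: "\<And>x. \<tau> < x \<Longrightarrow> x < \<tau> + w \<Longrightarrow> \<bar>signal \<theta> x\<bar> \<le> s"
  shows "(\<Sum>i\<in>{1..n} \<inter> {i. real i / real n < \<tau> + w}. (signal \<theta> (real i / real n))\<^sup>2)
    \<le> s\<^sup>2 * (real n * w + 1)"
proof -
  let ?I = "{1..n} \<inter> {i. \<tau> < real i / real n \<and> real i / real n < \<tau> + w}"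
  let ?J = "{i::nat. real n * \<tau> < real i \<and> real i < real n * \<tau> + real n * w}"
  have "?I \<subseteq> ?J" using n by (auto simp: field_simps)
  moreover have "finite ?J"
    by (rule finite_subset[of _ "{..nat \<lceil>real n * \<tau> + real n * w\<rceil>}"]) (auto, linarith)
  ultimately have "real (card ?I) \<le> real (card ?J)" by (simp add: card_mono)
  also have "\<dots> \<le> real n * w + 1"
    using \<tau> w by (intro card_nat_open_interval_le) auto
  finally have card: "real (card ?I) \<le> real n * w + 1" .
  have "(\<Sum>i\<in>{1..n} \<inter> {i. real i / real n < \<tau> + w}. (signal \<theta> (real i / real n))\<^sup>2)
      = (\<Sum>i\<in>?I. (signal \<theta> (real i / real n))\<^sup>2)"
    by (rule sum.mono_neutral_right) (auto intro: before simp flip: not_le)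
  also have "\<dots> \<le> (\<Sum>i\<in>?I. s\<^sup>2)"
  proof (rule sum_mono)
    fix i assume "i \<in> ?I"
    then have "\<bar>signal \<theta> (real i / real n)\<bar> \<le> s" by (intro after) auto
    then show "(signal \<theta> (real i / real n))\<^sup>2 \<le> s\<^sup>2"
      by (intro abs_le_square_iff[THEN iffD1]) simp
  qed
  also have "\<dots> = real (card ?I) * s\<^sup>2" by simp
  also have "\<dots> \<le> (real n * w + 1) * s\<^sup>2" using card by (rule mult_right_mono) simp
  finally show ?thesis by (simp add: mult.commute)
qed

text \<open>Reduces both cases to one numerical condition on \<open>w\<close> and \<open>s\<close>.
  Its right-hand side is a lower bound for a quarter of the number of candidates placed in
  \<open>[\<delta>0, 1 - \<delta>0]\<close> at spacing \<open>2 * w\<close>.\<close>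

lemma online_detector_minimax_ge:
  assumes n: "n > 0" and w: "w > 0" and \<delta>: "0 < \<delta>0" "\<delta>0 < 1 / 2"
    and \<theta>: "\<And>\<tau>. \<delta>0 \<le> \<tau> \<Longrightarrow> \<tau> \<le> 1 - \<delta>0 \<Longrightarrow> \<theta> \<tau> \<in> \<Theta>"
    and cp: "\<And>\<tau>. change_point (\<theta> \<tau>) = \<tau>"
    and before: "\<And>\<tau> x. x \<le> \<tau> \<Longrightarrow> signal (\<theta> \<tau>) x = 0"
    and after: "\<And>\<tau> x. \<tau> < x \<Longrightarrow> x < \<tau> + w \<Longrightarrow> \<bar>signal (\<theta> \<tau>) x\<bar> \<le> s"
    and small: "exp (s\<^sup>2 * (real n * w + 1)) \<le> ((1 - 2 * \<delta>0) / (2 * w) - 1) / 4"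
  shows "ennreal ((c * w)\<^sup>2 / 2) \<le> (INF T\<in>online_detectors n. SUP \<theta>\<in>\<Theta>. scaled_risk n c T \<theta>)"
proof (rule INF_greatest)
  fix T assume T: "T \<in> online_detectors n"
  define q where "q = (1 - 2 * \<delta>0) / (2 * w)"
  define M where "M = nat \<lfloor>q\<rfloor>"
  have "0 < q" using \<delta> w by (simp add: q_def)
  then have Mq: "real M \<le> q" "q - 1 \<le> real M" unfolding M_def by linarith+
  have small': "exp (s\<^sup>2 * (real n * w + 1)) \<le> real M / 4"
    using small[folded q_def] by (rule order_trans) (use Mq in simp)
  \<comment> \<open>Positivity of the exponential excludes an empty set of candidates.\<close>
  then have "0 < real M / 4" by (rule less_le_trans[OF exp_gt_zero])
  then have M: "M > 0" by simp
  have range: "\<delta>0 \<le> \<delta>0 + 2 * real j * w" "\<delta>0 + 2 * real j * w \<le> 1 - \<delta>0" if "j < M" for j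
  proof -
    have "real j \<le> q" using that Mq by linarith
    then have "2 * real j * w \<le> 1 - 2 * \<delta>0" using w by (simp add: q_def field_simps)
    then show "\<delta>0 + 2 * real j * w \<le> 1 - \<delta>0" by simp
    show "\<delta>0 \<le> \<delta>0 + 2 * real j * w" using w by simp
  qed
  show "ennreal ((c * w)\<^sup>2 / 2) \<le> (SUP \<theta>\<in>\<Theta>. scaled_risk n c T \<theta>)"
  proof (rule online_detector_risk_ge[OF T M w _ _ _ small'])
    fix j assume j: "j < M"
    show "\<theta> (\<delta>0 + 2 * real j * w) \<in> \<Theta>" using range[OF j] by (rule \<theta>)
    show "change_point (\<theta> (\<delta>0 + 2 * real j * w)) = \<delta>0 + 2 * real j * w" by (rule cp)
    show "(\<Sum>i\<in>{1..n} \<inter> {i. real i / real n < change_point (\<theta> (\<delta>0 + 2 * real j * w)) + w}.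
        (signal (\<theta> (\<delta>0 + 2 * real j * w)) (real i / real n))\<^sup>2) \<le> s\<^sup>2 * (real n * w + 1)"
      unfolding cp using n w \<delta> range[OF j] before after by (intro signal_energy_le) auto
  qed
qed

section \<open>The two rates\<close>

lemma jump_minimax_liminf_ge:
  assumes \<delta>: "0 < \<delta>0" "\<delta>0 < 1 / 2"
  shows "ennreal 2 \<le> liminf (\<lambda>n. INF T \<in> online_detectors n. SUP \<theta> \<in> jump_space \<delta>0.
    scaled_risk n (real n / ln (real n)) T \<theta>)"
proof (rule Liminf_bounded)
  \<comment> \<open>With \<open>s = 1 / 2\<close> the energy is \<open>(2 * ln n + 1) / 4\<close>,
    whose exponential is of order \<open>sqrt n\<close>, while there are of order
    \<open>n / ln n\<close> candidates. The scaled radius is \<open>2\<close>, which yields the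
    bound \<open>2\<^sup>2 / 2 = 2\<close>.\<close>
  define w where "w n = 2 * ln (real n) / real n" for n
  define d where "d = 1 - 2 * \<delta>0"
  have d: "0 < d" using \<delta> by (simp add: d_def)
  have "\<forall>\<^sub>F n in sequentially. exp ((1 / 2)\<^sup>2 * (real n * w n + 1)) \<le> (d / (2 * w n) - 1) / 4"
    unfolding w_def power2_eq_square using d by real_asymp
  then show "\<forall>\<^sub>F n in sequentially. ennreal 2 \<le> (INF T \<in> online_detectors n. SUP \<theta> \<in> jump_space \<delta>0.
    scaled_risk n (real n / ln (real n)) T \<theta>)"
    \<comment> \<open>For \<open>n > 1\<close> the logarithm is positive, hence so is
      \<open>w n\<close>, and the scaling factor cancels against it.\<close>
    using eventually_gt_at_top[of 1]
  proof eventually_elim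
    case (elim n)
    note elim = elim[unfolded d_def]
    have w: "w n > 0" using elim by (simp add: w_def)
    have "(real n / ln (real n) * w n)\<^sup>2 / 2 = 2" using elim by (simp add: w_def)
    moreover have "ennreal ((real n / ln (real n) * w n)\<^sup>2 / 2)
        \<le> (INF T\<in>online_detectors n. SUP \<theta>\<in>jump_space \<delta>0. scaled_risk n (real n / ln (real n)) T \<theta>)"
    \<comment> \<open>A step of the least admissible height; \<open>\<delta>0 < 1 / 2\<close> gives
      the value of \<open>s\<close>.\<close>
    proof (rule online_detector_minimax_ge[where s = "1 / 2" and \<theta> = "\<lambda>\<tau>. (\<tau>, 0, \<delta>0, 0, 0)"])
      show "(\<tau>, 0, \<delta>0, 0, 0) \<in> jump_space \<delta>0" if "\<delta>0 \<le> \<tau>" "\<tau> \<le> 1 - \<delta>0" for \<tau>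
        using that \<delta> by (auto simp: jump_space_def param_space_def)
    qed (use elim w \<delta> in auto)
    ultimately show ?case by simp
  qed
qed

lemma kink_minimax_liminf_ge:
  assumes \<delta>: "0 < \<delta>0" "\<delta>0 < 1 / 2"
  shows "ennreal (1 / 2) \<le> liminf (\<lambda>n. INF T \<in> online_detectors n. SUP \<theta> \<in> kink_space \<delta>0.
    scaled_risk n (real n powr (1 / 3) / ln (real n) powr (1 / 3)) T \<theta>)"
proof (rule Liminf_bounded)
  \<comment> \<open>The reciprocal of the scaling factor, so the bound becomes
    \<open>1\<^sup>2 / 2\<close>.\<close>
  define w where "w n = ln (real n) powr (1 / 3) / real n powr (1 / 3)" for n
  define d where "d = 1 - 2 * \<delta>0"
  have d: "0 < d" using \<delta> by (simp add: d_def)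
  \<comment> \<open>Since \<open>n * (w n) ^ 3 = ln n\<close>, the energy is \<open>ln n / 4\<close>
    plus a vanishing term. Its exponential is of order \<open>n powr (1 / 4)\<close>, below the
    number of candidates, which is of order \<open>(n / ln n) powr (1 / 3)\<close>.\<close>
  have energy: "(w n / 2)\<^sup>2 * (real n * w n + 1)
      = 1 / 4 * (ln (real n) + ln (real n) powr (2 / 3) / real n powr (2 / 3))" if "n > 1" for n
  proof -
    have w2: "(w n)\<^sup>2 = ln (real n) powr (2 / 3) / real n powr (2 / 3)"
      using that by (simp add: w_def power_divide powr_power)
    have "(w n) ^ 3 = ln (real n) / real n"
      using that by (simp add: w_def power_divide powr_power)
    then have "real n * (w n) ^ 3 = ln (real n)" using that by simp
    moreover have "(w n / 2)\<^sup>2 * (real n * w n + 1) = 1 / 4 * (real n * (w n) ^ 3 + (w n)\<^sup>2)"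
      by (simp add: power2_eq_square power3_eq_cube field_simps)
    ultimately show ?thesis by (simp add: w2)
  qed
  have "\<forall>\<^sub>F n in sequentially.
      exp (1 / 4 * (ln (real n) + ln (real n) powr (2 / 3) / real n powr (2 / 3)))
        \<le> (d / (2 * w n) - 1) / 4"
    unfolding w_def using d by real_asymp
  then have "\<forall>\<^sub>F n in sequentially.
      exp ((w n / 2)\<^sup>2 * (real n * w n + 1)) \<le> (d / (2 * w n) - 1) / 4"
    using eventually_gt_at_top[of 1] by eventually_elim (simp only: energy)
  then show "\<forall>\<^sub>F n in sequentially. ennreal (1 / 2) \<le> (INF T \<in> online_detectors n. SUP \<theta> \<in> kink_space \<delta>0.
    scaled_risk n (real n powr (1 / 3) / ln (real n) powr (1 / 3)) T \<theta>)"
    using eventually_gt_at_top[of 1]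
  proof eventually_elim
    case (elim n)
    note elim = elim[unfolded d_def]
    let ?c = "real n powr (1 / 3) / ln (real n) powr (1 / 3)"
    have w: "w n > 0" using elim by (simp add: w_def)
    have "(?c * w n)\<^sup>2 / 2 = 1 / 2" using elim by (simp add: w_def)
    moreover have "ennreal ((?c * w n)\<^sup>2 / 2)
        \<le> (INF T\<in>online_detectors n. SUP \<theta>\<in>kink_space \<delta>0. scaled_risk n ?c T \<theta>)"
    \<comment> \<open>A continuous signal, hence outside the jump space, with the least admissible
      change of slope; over a window of length \<open>w n\<close> it rises by at most
      \<open>w n / 2\<close>.\<close>
    proof (rule online_detector_minimax_ge[where s = "w n / 2" and \<theta> = "\<lambda>\<tau>. (\<tau>, 0, 0, 0, \<delta>0)"])
      show "(\<tau>, 0, 0, 0, \<delta>0) \<in> kink_space \<delta>0" if "\<delta>0 \<le> \<tau>" "\<tau> \<le> 1 - \<delta>0" for \<tau>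
        using that \<delta> by (auto simp: kink_space_def jump_space_def param_space_def)
      show "\<bar>signal (\<tau>, 0, 0, 0, \<delta>0) x\<bar> \<le> w n / 2" if "\<tau> < x" "x < \<tau> + w n" for \<tau> x
        using mult_mono[of \<delta>0 "1 / 2" "x - \<tau>" "w n"] that \<delta> by (simp add: abs_mult)
    qed (use elim w \<delta> in auto)
    ultimately show ?case by simp
  qed
qed

theorem theorem5:
  fixes \<delta>0 :: real
  assumes "0 < \<delta>0" and "\<delta>0 < 1 / 2"
  shows "\<exists>rJ rK :: real. rJ > 0 \<and> rK > 0 \<and>
    liminf (\<lambda>n. INF T \<in> online_detectors n. SUP \<theta> \<in> jump_space \<delta>0.
        scaled_risk n (real n / ln (real n)) T \<theta>) \<ge> ennreal rJ \<and>
    liminf (\<lambda>n. INF T \<in> online_detectors n. SUP \<theta> \<in> kink_space \<delta>0.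
        scaled_risk n (real n powr (1 / 3) / ln (real n) powr (1 / 3)) T \<theta>) \<ge> ennreal rK"
  using jump_minimax_liminf_ge[OF assms] kink_minimax_liminf_ge[OF assms]
  \<comment> \<open>The same two constants serve every \<open>\<delta>0\<close>.\<close>
  by (intro exI[of _ 2] exI[of _ "1 / 2"]) simp

end
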